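(* Let $B$ be a finite edge-clean bidirected graph rooted at $r$, let $x\in V(B)\setminus\{r\}$, and let $\mathcal P$ and $\mathcal Q$ be sets of pairwise edge-disjoint $r$--$x$ paths in $B$. Then there is a set $\mathcal R$ of pairwise edge-disjoint $r$--$x$ paths in $B$ covering the first edges of the paths in $\mathcal P$ and the last edges of the paths in $\mathcal Q$ (that is, each of these edges lies on some path in $\mathcal R$).
   Context: A bidirected graph $B=(G,\sigma)$ is a loopless multigraph $G$ together with a map $\sigma$ assigning to each half-edge $(e,u)$ ($u$ an endpoint of the edge $e$) a sign $\sigma(e,u)\in\{+,-\}$. An oriented edge $\vec e$ is an edge $e$ with a choice of which endpoint is its tail and which its head; $\overleftarrow{e}$ is the opposite orientation. A trail is a sequence $v_0\vec e_1v_1\dots\vec e_\ell v_\ell$ in which the edges $e_i$ are pairwise distinct, $\vec e_i$ has tail $v_{i-1}$ and head $v_i$, and $\sigma(e_{i+1},v_i)=-\sigma(e_i,v_i)$ for $1\le i<\ell$; it is a $v_0$--$v_\ell$ trail. A path is a trail that does not repeat vertices. Two trails are edge-disjoint if they share no underlying edge. $B$ is rooted if it has a designated root vertex $r$. An $r$-trail is a trail starting in $r$ with no internal vertex equal to $r$. An $r$--$\vec e$ trail is an $r$-trail whose last oriented edge is $\vec e$. An edge $e$ is trail-undirectable if there are both an $r$--$\vec e$ trail and an $r$--$\overleftarrow{e}$ trail. $B$ is edge-clean if no trail-undirectable edge is incident with $r$ (equivalently, $r$ lies in no nontrivial connected component of the subgraph formed by the trail-undirectable edges). *)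

theory Defs
  imports Main
begin

datatype sign = Plus | Minus

primrec opposite :: "sign \<Rightarrow> sign" where
  "opposite Plus = Minus"
| "opposite Minus = Plus"

text \<open>The value \<open>sign_of B e u\<close> is meaningful only if \<open>e\<close> is an edge of \<open>B\<close> and \<open>u\<close> is an
  endpoint of \<open>e\<close>, i.e. if \<open>(e, u)\<close> is a half-edge; no definition below uses other values.\<close>

record ('v, 'e) bidirected_graph =
  verts :: "'v set"
  edges :: "'e set"
  ends :: "'e \<Rightarrow> 'v set"
  sign_of :: "'e \<Rightarrow> 'v \<Rightarrow> sign"

text \<open>Two distinct endpoints per edge: parallel edges are allowed, loops are not.\<close>

definition bidirected_graph :: "('v, 'e) bidirected_graph \<Rightarrow> bool" where
  "bidirected_graph B \<longleftrightarrow> (\<forall>e\<in>edges B. ends B e \<subseteq> verts B \<and> card (ends B e) = 2)"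

definition finite_bidirected_graph :: "('v, 'e) bidirected_graph \<Rightarrow> bool" where
  "finite_bidirected_graph B \<longleftrightarrow> bidirected_graph B \<and> finite (verts B) \<and> finite (edges B)"

datatype ('v, 'e) oriented_edge = OEdge (tail: 'v) (edge: 'e) (head: 'v)

definition oriented_edges :: "('v, 'e) bidirected_graph \<Rightarrow> ('v, 'e) oriented_edge set" where
  "oriented_edges B = {a. edge a \<in> edges B \<and> ends B (edge a) = {tail a, head a}}"

definition reversal :: "('v, 'e) oriented_edge \<Rightarrow> ('v, 'e) oriented_edge" where
  "reversal a = OEdge (head a) (edge a) (tail a)"

text \<open>A trail \<open>v\<^sub>0 e\<^sub>1 v\<^sub>1 \<dots> e\<^sub>l v\<^sub>l\<close> is represented by \<open>v\<^sub>0\<close> and the list of its oriented edges;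
  its vertex sequence is then the following list.\<close>

definition trail_verts :: "'v \<Rightarrow> ('v, 'e) oriented_edge list \<Rightarrow> 'v list" where
  "trail_verts u p = u # map head p"

text \<open>The equation between lists says that the \<open>i\<close>-th oriented edge has tail \<open>v\<^sub>i\<^sub>-\<^sub>1\<close> and
  that the last vertex \<open>v\<^sub>l\<close> is \<open>w\<close>. The trivial trail (\<open>p = []\<close>, \<open>u = w\<close>) is included.\<close>

definition trail ::
  "('v, 'e) bidirected_graph \<Rightarrow> 'v \<Rightarrow> ('v, 'e) oriented_edge list \<Rightarrow> 'v \<Rightarrow> bool" where
  "trail B u p w \<longleftrightarrow>
     u \<in> verts B \<and>
     set p \<subseteq> oriented_edges B \<and>
     distinct (map edge p) \<and>
     trail_verts u p = map tail p @ [w] \<and>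
     successively (\<lambda>a b. sign_of B (edge b) (head a) = opposite (sign_of B (edge a) (head a))) p"

definition path ::
  "('v, 'e) bidirected_graph \<Rightarrow> 'v \<Rightarrow> ('v, 'e) oriented_edge list \<Rightarrow> 'v \<Rightarrow> bool" where
  "path B u p w \<longleftrightarrow> trail B u p w \<and> distinct (trail_verts u p)"

definition edge_disjoint ::
  "('v, 'e) oriented_edge list \<Rightarrow> ('v, 'e) oriented_edge list \<Rightarrow> bool" where
  "edge_disjoint p q \<longleftrightarrow> edge ` set p \<inter> edge ` set q = {}"

definition edge_disjoint_paths ::
  "('v, 'e) bidirected_graph \<Rightarrow> 'v \<Rightarrow> 'v \<Rightarrow> ('v, 'e) oriented_edge list set \<Rightarrow> bool" where
  "edge_disjoint_paths B u w P \<longleftrightarrow> (\<forall>p\<in>P. path B u p w) \<and> pairwise edge_disjoint P"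

text \<open>Only internal vertices must differ from the root: an \<open>r\<close>-trail may end in \<open>r\<close>.\<close>

definition root_trail ::
  "('v, 'e) bidirected_graph \<Rightarrow> 'v \<Rightarrow> ('v, 'e) oriented_edge list \<Rightarrow> 'v \<Rightarrow> bool" where
  "root_trail B r p w \<longleftrightarrow> trail B r p w \<and> r \<notin> set (butlast (map head p))"

definition root_trail_to_edge ::
  "('v, 'e) bidirected_graph \<Rightarrow> 'v \<Rightarrow> ('v, 'e) oriented_edge list \<Rightarrow> ('v, 'e) oriented_edge \<Rightarrow> bool" where
  "root_trail_to_edge B r p a \<longleftrightarrow> root_trail B r p (head a) \<and> p \<noteq> [] \<and> last p = a"

definition trail_undirectable :: "('v, 'e) bidirected_graph \<Rightarrow> 'v \<Rightarrow> 'e \<Rightarrow> bool" where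
  "trail_undirectable B r e \<longleftrightarrow>
     (\<exists>a\<in>oriented_edges B. edge a = e \<and>
        (\<exists>p. root_trail_to_edge B r p a) \<and> (\<exists>q. root_trail_to_edge B r q (reversal a)))"

definition edge_clean :: "('v, 'e) bidirected_graph \<Rightarrow> 'v \<Rightarrow> bool" where
  "edge_clean B r \<longleftrightarrow> (\<forall>e\<in>edges B. r \<in> ends B e \<longrightarrow> \<not> trail_undirectable B r e)"

end

(*
An r-trail is an alternating path in disguise, and the trail-undirectable edges behave like
Edmonds' blossoms. The last directable edge on an r-trail ending in an undirectable edge e does
not depend on the trail (nor on the direction in which e is traversed); call it the bud of e. It
plays the role of the base of the blossom containing e. More generally, if two r-trails end in the
same vertex, one of them with an undirectable edge, then they have the same last directable edge.

The linkage is then obtained as in the proof of Pym's theorem. Let each path in P rank the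
directable edges it shares with paths in Q by preferring early ones, and let each path in Q
prefer late ones. A stable matching selects edges at which to switch from P to Q. Stability rules
out a conflict at a directable edge directly; a conflict at an undirectable edge would make its
bud, which lies on both paths, a blocking edge. Vertex repetitions are removed by switching at the
first vertex shared with the rest of the path in Q; signs agree there, again because of buds.
*)
theory Submission
  imports Defs
begin

section \<open>Stable sets for two strict orders\<close>

text \<open>Stable matching as a fixed point, where \<open>R s e\<close> reads as \<open>s\<close>
  being preferred to \<open>e\<close>. Let \<open>X\<close> consist of what no member of
  \<open>Y\<close> beats under \<open>R2\<close>, and \<open>Y\<close> of what no member of
  \<open>X\<close> beats under \<open>R1\<close>; the intersection of \<open>X\<close> and
  \<open>Y\<close> is stable.\<close>

lemma stable_set_exists:
  assumes "finite E"
    and "transp_on E R1" "irreflp_on E R1"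
    and "transp_on E R2" "irreflp_on E R2"
  obtains S where "S \<subseteq> E"
    "\<And>s t. \<lbrakk>s \<in> S; t \<in> S\<rbrakk> \<Longrightarrow> \<not> R1 s t \<and> \<not> R2 s t"
    "\<And>e. \<lbrakk>e \<in> E; e \<notin> S\<rbrakk> \<Longrightarrow> \<exists>s\<in>S. R1 s e \<or> R2 s e"
proof -
  define D1 where "D1 X = {e \<in> E. \<exists>s\<in>X. R1 s e}" for X
  define D2 where "D2 X = {e \<in> E. \<exists>s\<in>X. R2 s e}" for X
  have D1: "D1 X \<subseteq> D1 Y" and D2: "D2 X \<subseteq> D2 Y" if "X \<subseteq> Y" for X Y
    using that unfolding D1_def D2_def by blast+
  \<comment> \<open>Each complement reverses inclusion, so the composition is monotone and has a
    fixed point by Knaster-Tarski.\<close>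
  have "mono (\<lambda>X. E - D2 (E - D1 X))"
    by (intro monoI Diff_mono D1 D2 order_refl)
  then obtain X where X: "X = E - D2 (E - D1 X)"
    using lfp_unfold by blast
  define Y where "Y = E - D1 X"
  have XY: "e \<in> X \<longleftrightarrow> e \<in> E \<and> (\<forall>s\<in>Y. \<not> R2 s e)" for e
    using X unfolding D2_def[of Y] Y_def[symmetric] by blast
  have YX: "e \<in> Y \<longleftrightarrow> e \<in> E \<and> (\<forall>s\<in>X. \<not> R1 s e)" for e
    unfolding Y_def D1_def by blast
  have sub: "X \<subseteq> E" "Y \<subseteq> E" using XY YX by blast+
  \<comment> \<open>Take a minimal element among those of \<open>Z\<close> that beat
    \<open>e\<close>. By transitivity, whatever beats it also beats \<open>e\<close>, so it is
    minimal in all of \<open>Z\<close>.\<close>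
  have least: "\<exists>s\<in>Z. R s e \<and> (\<forall>t\<in>Z. \<not> R t s)"
    if "Z \<subseteq> E" "transp_on E R" "irreflp_on E R" "e \<in> E" "s \<in> Z" "R s e" for Z R s e
  proof -
    have "finite Z" using that(1) assms(1) finite_subset by blast
    moreover have "transp_on Z R" using that(1,2) transp_on_subset by blast
    moreover have "asymp_on Z R"
    proof (rule asymp_onI)
      fix a b assume "a \<in> Z" "b \<in> Z" "R a b"
      then show "\<not> R b a"
        using that(1) transp_onD[OF that(2), of a b a] irreflp_onD[OF that(3), of a] by auto
    qed
    ultimately have "\<exists>s\<in>Z. R s e \<and> (\<forall>t\<in>Z. R t s \<longrightarrow> \<not> R t e)"
      using Finite_Set.bex_min_element_with_property[of Z R "\<lambda>s. R s e"] that(5,6) by blast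
    then obtain s where "s \<in> Z" "R s e" "\<forall>t\<in>Z. R t s \<longrightarrow> \<not> R t e" by blast
    moreover have "R t e" if "t \<in> Z" "R t s" for t
      using transp_onD[OF \<open>transp_on E R\<close>, of t s e] that \<open>Z \<subseteq> E\<close> \<open>e \<in> E\<close> \<open>s \<in> Z\<close> \<open>R s e\<close> by blast
    ultimately show ?thesis by blast
  qed
  show thesis
  proof
    show "X \<inter> Y \<subseteq> E" using sub by blast
    show "\<not> R1 s t \<and> \<not> R2 s t" if "s \<in> X \<inter> Y" "t \<in> X \<inter> Y" for s t
      using that XY[of t] YX[of t] by blast
    \<comment> \<open>An element of \<open>X\<close> outside \<open>Y\<close> is beaten by a member
      of \<open>X\<close>; one that is itself unbeaten in \<open>X\<close> under \<open>R1\<close>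
      also lies in \<open>Y\<close>. The other case is symmetric.\<close>
    show "\<exists>s\<in>X \<inter> Y. R1 s e \<or> R2 s e" if e: "e \<in> E" "e \<notin> X \<inter> Y" for e
    proof (cases "e \<in> X")
      case True
      then obtain s where "s \<in> X" "R1 s e" using e YX[of e] by blast
      then obtain m where "m \<in> X" "R1 m e" "\<forall>t\<in>X. \<not> R1 t m"
        using least[OF sub(1) assms(2,3) e(1)] by blast
      then show ?thesis using YX[of m] sub by blast
    next
      case False
      then obtain s where "s \<in> Y" "R2 s e" using e XY[of e] by blast
      then obtain m where "m \<in> Y" "R2 m e" "\<forall>t\<in>Y. \<not> R2 t m"
        using least[OF sub(2) assms(4,5) e(1)] by blast
      then show ?thesis using XY[of m] sub by blast
    qed
  qed
qed

section \<open>Signs, reversal, and trails as linked lists\<close>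

lemma opposite_opposite [simp]: "opposite (opposite s) = s"
  by (cases s) auto

lemma neq_imp_opposite: "s \<noteq> t \<Longrightarrow> s = opposite t"
  by (cases s; cases t) auto

lemma opposite_neq [simp]: "opposite s \<noteq> s" "s \<noteq> opposite s"
  by (cases s; simp)+

lemma reversal_simps [simp]:
  "tail (reversal a) = head a" "head (reversal a) = tail a" "edge (reversal a) = edge a"
  "reversal (reversal a) = a"
  by (simp_all add: reversal_def)

lemma reversal_oriented_edges [simp]:
  "reversal a \<in> oriented_edges B \<longleftrightarrow> a \<in> oriented_edges B"
  by (auto simp: oriented_edges_def)

lemma same_edge_cases:
  assumes "a \<in> oriented_edges B" "b \<in> oriented_edges B" "edge a = edge b"
  shows "a = b \<or> a = reversal b"
  using assms by (cases a; cases b) (auto simp: oriented_edges_def reversal_def doubleton_eq_iff)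

lemma finite_oriented_edges:
  assumes "finite_bidirected_graph B"
  shows "finite (oriented_edges B)"
proof (rule finite_subset)
  show "oriented_edges B \<subseteq> (\<lambda>(u, e, v). OEdge u e v) ` (verts B \<times> edges B \<times> verts B)"
  proof
    fix a assume a: "a \<in> oriented_edges B"
    then have "tail a \<in> verts B" "head a \<in> verts B" "edge a \<in> edges B"
      using assms unfolding finite_bidirected_graph_def bidirected_graph_def oriented_edges_def
      by auto
    then show "a \<in> (\<lambda>(u, e, v). OEdge u e v) ` (verts B \<times> edges B \<times> verts B)"
      by (intro image_eqI[of _ _ "(tail a, edge a, head a)"]) auto
  qed
  show "finite ((\<lambda>(u, e, v). OEdge u e v) ` (verts B \<times> edges B \<times> verts B))"
    using assms by (simp add: finite_bidirected_graph_def)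
qed

text \<open>Joining incidence and the sign condition in one relation makes the reversal of a trail a
  matter of \<open>link_reversal\<close>.\<close>

definition link ::
  "('v, 'e) bidirected_graph \<Rightarrow> ('v, 'e) oriented_edge \<Rightarrow> ('v, 'e) oriented_edge \<Rightarrow> bool" where
  "link B a b \<longleftrightarrow> head a = tail b \<and>
     sign_of B (edge b) (head a) = opposite (sign_of B (edge a) (head a))"

lemma link_reversal: "link B (reversal b) (reversal a) \<longleftrightarrow> link B a b"
  by (auto simp: link_def)

lemma trail_verts_eq_iff:
  assumes "p \<noteq> []"
  shows "trail_verts u p = map tail p @ [w] \<longleftrightarrow>
     u = tail (hd p) \<and> head (last p) = w \<and> successively (\<lambda>a b. head a = tail b) p"
  using assms
proof (induction p arbitrary: u rule: list_nonempty_induct)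
  case (single a)
  then show ?case by (simp add: trail_verts_def)
next
  case (cons a p)
  have "trail_verts u (a # p) = map tail (a # p) @ [w] \<longleftrightarrow>
      u = tail a \<and> trail_verts (head a) p = map tail p @ [w]"
    by (simp add: trail_verts_def)
  also note cons.IH
  finally show ?case
    using cons.hyps by (simp add: successively_Cons conj_ac)
qed

lemma successively_conj:
  "successively (\<lambda>a b. P a b \<and> Q a b) xs \<longleftrightarrow> successively P xs \<and> successively Q xs"
  by (induction xs rule: induct_list012) auto

lemma trail_iff:
  assumes "p \<noteq> []"
  shows "trail B u p w \<longleftrightarrow> u \<in> verts B \<and> set p \<subseteq> oriented_edges B \<and> distinct (map edge p) \<and>
     tail (hd p) = u \<and> head (last p) = w \<and> successively (link B) p"
  unfolding trail_def trail_verts_eq_iff[OF assms] link_def[abs_def] successively_conj by blast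

lemma distinct_split_unique:
  assumes "distinct (u @ a # v)" "u @ a # v = u' @ a # v'"
  shows "u = u' \<and> v = v'"
proof -
  have "a \<notin> set u" "a \<notin> set v" using assms(1) by simp_all
  then show ?thesis using assms(2) append_Cons_eq_iff by metis
qed

section \<open>Root trails in an edge-clean graph\<close>

locale edge_clean_graph =
  fixes B :: "('v, 'e) bidirected_graph" and r :: 'v
  assumes finite_graph: "finite_bidirected_graph B" and clean: "edge_clean B r" and root_vert: "r \<in> verts B"
begin

abbreviation directable :: "('v, 'e) oriented_edge \<Rightarrow> bool" where
  "directable a \<equiv> \<not> trail_undirectable B r (edge a)"

lemma reversal_neq:
  assumes "a \<in> oriented_edges B"
  shows "a \<noteq> reversal a"
proof
  assume "a = reversal a"
  then have "head a = tail a" by (metis reversal_simps(1))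
  then have "card (ends B (edge a)) = 1" using assms by (simp add: oriented_edges_def)
  then show False
    using assms finite_graph
    by (auto simp: oriented_edges_def finite_bidirected_graph_def bidirected_graph_def)
qed

text \<open>Nontrivial \<open>r\<close>-trails, with the end vertex left implicit as
  \<open>head (last p)\<close>; this suits cutting and concatenating lists.\<close>

definition rtrail :: "('v, 'e) oriented_edge list \<Rightarrow> bool" where
  "rtrail p \<longleftrightarrow> p \<noteq> [] \<and> tail (hd p) = r \<and> set p \<subseteq> oriented_edges B \<and> distinct (map edge p) \<and>
     successively (link B) p \<and> r \<notin> set (butlast (map head p))"

lemma root_trail_to_edge_iff: "root_trail_to_edge B r p a \<longleftrightarrow> rtrail p \<and> last p = a"
  unfolding root_trail_to_edge_def root_trail_def rtrail_def
  using root_vert by (cases "p = []") (auto simp: trail_iff)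

lemma rtrail_edges: "rtrail p \<Longrightarrow> b \<in> set p \<Longrightarrow> b \<in> oriented_edges B"
  by (auto simp: rtrail_def)

lemma undirectableI:
  assumes "rtrail p" "rtrail q" "last q = reversal (last p)"
  shows "\<not> directable (last p)"
proof -
  have "last p \<in> oriented_edges B" using assms(1) by (auto simp: rtrail_def)
  then show ?thesis using assms
    unfolding trail_undirectable_def root_trail_to_edge_iff by auto
qed

lemma undirectableE:
  assumes "\<not> directable a" "a \<in> oriented_edges B"
  obtains p where "rtrail p" "last p = a"
proof -
  obtain b where b: "b \<in> oriented_edges B" "edge b = edge a"
      "\<exists>p. rtrail p \<and> last p = b" "\<exists>p. rtrail p \<and> last p = reversal b"
    using assms(1) unfolding trail_undirectable_def root_trail_to_edge_iff by blast
  then have "a = b \<or> a = reversal b" using same_edge_cases[OF assms(2) b(1)] by simp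
  then show thesis using b that by blast
qed

lemma directable_at_root:
  assumes "a \<in> oriented_edges B" "tail a = r \<or> head a = r"
  shows "directable a"
  using clean assms unfolding edge_clean_def oriented_edges_def by auto

lemma rtrail_prefix:
  assumes "rtrail (p @ q)" "p \<noteq> []"
  shows "rtrail p"
proof -
  have "set (butlast (map head p)) \<subseteq> set (butlast (map head (p @ q)))"
    by (cases "q = []") (auto simp: butlast_append dest: in_set_butlastD)
  then have "r \<notin> set (butlast (map head p))" using assms(1) unfolding rtrail_def by blast
  then show ?thesis using assms by (simp add: rtrail_def successively_append_iff)
qed

lemma rtrail_prefix_last:
  "rtrail (u @ b # v) \<Longrightarrow> rtrail (u @ [b])"
  using rtrail_prefix[of "u @ [b]" v] by simp

lemma rtrail_split:
  assumes "rtrail p" "b \<in> set p"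
  obtains u v where "p = u @ b # v" "rtrail (u @ [b])"
proof -
  obtain u v where "p = u @ b # v" using split_list[OF assms(2)] by blast
  then show thesis using that rtrail_prefix_last assms(1) by blast
qed

text \<open>Two trails using the edge in opposite directions could be cut off there, and the two
  prefixes would make it undirectable.\<close>

lemma directable_same_orientation:
  assumes "rtrail p" "rtrail q" "a \<in> set p" "b \<in> set q" "edge a = edge b" "directable a"
  shows "a = b"
proof (rule ccontr)
  assume "a \<noteq> b"
  moreover have "a \<in> oriented_edges B" "b \<in> oriented_edges B"
    using rtrail_edges assms(1-4) by blast+
  ultimately have ba: "b = reversal a"
    using same_edge_cases[of b B a] assms(5) by metis
  obtain u where "rtrail (u @ [a])" using rtrail_split[OF assms(1,3)] by metis
  moreover obtain u' where "rtrail (u' @ [b])" using rtrail_split[OF assms(2,4)] by metis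
  ultimately show False
    using undirectableI[of "u @ [a]" "u' @ [b]"] ba assms(6) by simp
qed

lemma rtrail_single:
  assumes "a \<in> oriented_edges B" "tail a = r"
  shows "rtrail [a]"
  using assms by (simp add: rtrail_def)

text \<open>If a trail returned to \<open>r\<close> along \<open>b\<close>, the one-edge trail along
  the reversal of \<open>b\<close> would make \<open>b\<close> undirectable, against
  edge-cleanness.\<close>

lemma rtrail_head_neq_root:
  assumes "rtrail p" "b \<in> set p"
  shows "head b \<noteq> r"
proof
  assume "head b = r"
  obtain u where "rtrail (u @ [b])" using rtrail_split[OF assms] by metis
  moreover have "rtrail [reversal b]"
    using rtrail_single rtrail_edges[OF assms] \<open>head b = r\<close> by simp
  ultimately have "\<not> directable b"
    using undirectableI[of "u @ [b]" "[reversal b]"] by simp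
  then show False using directable_at_root rtrail_edges[OF assms] \<open>head b = r\<close> by blast
qed

lemma rtrail_append:
  assumes "rtrail p" "q \<noteq> []" "link B (last p) (hd q)" "successively (link B) q"
    and "set q \<subseteq> oriented_edges B" "distinct (map edge q)"
    and "edge ` set p \<inter> edge ` set q = {}" "r \<notin> head ` set (butlast q)"
  shows "rtrail (p @ q)"
proof -
  have "r \<notin> head ` set p" using rtrail_head_neq_root[OF assms(1)] by blast
  then have "r \<notin> set (butlast (map head (p @ q)))"
    using assms(2,8) by (simp add: butlast_append map_butlast[symmetric])
  then show ?thesis
    using assms(1-7) unfolding rtrail_def by (simp add: successively_append_iff)
qed

lemma rtrail_snoc:
  assumes "rtrail p" "link B (last p) b" "b \<in> oriented_edges B" "edge b \<notin> edge ` set p"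
  shows "rtrail (p @ [b])"
  using rtrail_append[OF assms(1), of "[b]"] assms by auto

lemma rtrail_tail:
  assumes "rtrail (u @ b # v)" "u \<noteq> []"
  shows "link B (last u) b" "tail b \<noteq> r"
proof -
  show "link B (last u) b" using assms by (auto simp: rtrail_def successively_append_iff)
  then have "tail b = head (last u)" by (simp add: link_def)
  then show "tail b \<noteq> r" using rtrail_head_neq_root[OF assms(1)] assms(2) by auto
qed

section \<open>Rerouting one root trail into another\<close>

text \<open>Let \<open>h\<close> be the first edge of \<open>q\<close> that \<open>s2\<close> also
  uses. If both traverse it alike, \<open>q\<close> up to \<open>h\<close> continues along
  \<open>s\<close>. Otherwise it continues backwards along \<open>s\<close> and finally traverses
  \<open>a\<close> in reverse, which would make \<open>a\<close> undirectable.\<close>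

lemma rtrail_merge:
  assumes s: "rtrail (s1 @ a # s2)" and q: "rtrail q" and a: "directable a" "a \<notin> set q"
    and "edge (last q) \<in> edge ` set s2"
  obtains q1 h q2 t1 t2 where "q = q1 @ h # q2" "s2 = t1 @ h # t2" "rtrail (q1 @ h # t2)"
proof -
  have "\<exists>b\<in>set q. edge b \<in> edge ` set s2"
    using assms(5) q by (auto simp: rtrail_def)
  then obtain q1 h q2 where q_eq: "q = q1 @ h # q2" and h: "edge h \<in> edge ` set s2"
    and first: "\<forall>b\<in>set q1. edge b \<notin> edge ` set s2"
    by (rule split_list_first_propE)
  obtain g where "g \<in> set s2" "edge g = edge h" using h by force
  then obtain t1 t2 where s2: "s2 = t1 @ g # t2" using split_list by metis
  \<comment> \<open>A directable edge has only one possible direction, so avoiding \<open>a\<close>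
    means avoiding its edge altogether.\<close>
  have aq: "edge a \<notin> edge ` set q"
    using directable_same_orientation[OF s q, of a] a by force
  have rh: "rtrail (q1 @ [h])" using q q_eq rtrail_prefix_last by simp
  have mem: "h \<in> oriented_edges B" "g \<in> oriented_edges B"
    using q q_eq s s2 by (auto simp: rtrail_def)
  show thesis
  proof (cases "h = g")
    case True
    have "rtrail (q1 @ h # t2)"
    proof (cases "t2 = []")
      case True
      then show ?thesis using rh by simp
    next
      case False
      have "rtrail ((q1 @ [h]) @ t2)"
      proof (rule rtrail_append[OF rh False])
        show "link B (last (q1 @ [h])) (hd t2)" "successively (link B) t2"
          using s s2 True False by (auto simp: rtrail_def successively_append_iff successively_Cons)
        show "set t2 \<subseteq> oriented_edges B" "distinct (map edge t2)"
          using s s2 by (auto simp: rtrail_def)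
        show "edge ` set (q1 @ [h]) \<inter> edge ` set t2 = {}"
          using first s s2 True by (auto simp: rtrail_def)
        show "r \<notin> head ` set (butlast t2)"
          using rtrail_head_neq_root[OF s] s2 by (auto dest!: in_set_butlastD)
      qed
      then show ?thesis by simp
    qed
    then show ?thesis using that q_eq s2 True by blast
  next
    case False
    then have hg: "h = reversal g" using same_edge_cases mem \<open>edge g = edge h\<close> by metis
    \<comment> \<open>The stretch of \<open>s\<close> from \<open>a\<close> to just before
      \<open>g\<close>, walked backwards.\<close>
    let ?c = "map reversal (rev (a # t1))"
    have "rtrail ((q1 @ [h]) @ ?c)"
    proof (rule rtrail_append[OF rh])
      show "?c \<noteq> []" by simp
      have "link B (last (a # t1)) g"
        using s s2 rtrail_tail(1)[of "s1 @ a # t1" g t2] by simp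
      then show "link B (last (q1 @ [h])) (hd ?c)"
        using hg by (simp add: link_reversal hd_map hd_rev del: rev.simps last.simps list.map)
      have "successively (link B) (a # t1)"
        using s s2 by (auto simp: rtrail_def successively_append_iff successively_Cons)
      then show "successively (link B) ?c"
        by (simp add: successively_map successively_rev link_reversal del: rev.simps list.map)
      show "set ?c \<subseteq> oriented_edges B" using s s2 by (auto simp: rtrail_def)
      show "distinct (map edge ?c)"
      proof -
        have "map edge ?c = rev (map edge (a # t1))"
          by (simp only: rev_map map_map comp_def reversal_simps)
        moreover have "distinct (map edge (a # t1))" using s s2 by (auto simp: rtrail_def)
        ultimately show ?thesis by (simp only: distinct_rev)
      qed
      show "edge ` set (q1 @ [h]) \<inter> edge ` set ?c = {}"
        using first s s2 aq q_eq \<open>edge g = edge h\<close> by (auto simp: rtrail_def)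
      \<comment> \<open>Omitting the last edge of \<open>?c\<close> matters here, as
        \<open>tail a\<close> may be \<open>r\<close>.\<close>
      show "r \<notin> head ` set (butlast ?c)"
      proof -
        have "tail b \<noteq> r" if b: "b \<in> set t1" for b
        proof -
          obtain u v where "t1 = u @ b # v" using split_list[OF b] by blast
          then show ?thesis using rtrail_tail(2)[of "s1 @ a # u" b "v @ g # t2"] s s2 by simp
        qed
        then have "r \<notin> tail ` set t1" by blast
        then show ?thesis by (simp add: image_image)
      qed
    qed
    then have "\<not> directable a"
      using undirectableI[OF rtrail_prefix_last[OF s]] by simp
    then show ?thesis using a by blast
  qed
qed

text \<open>Here \<open>q\<close> first meets \<open>p2\<close> in an edge \<open>g\<close> traversed in the same direction as by \<open>p2\<close>, since
  otherwise following \<open>p2\<close> backwards would traverse \<open>a\<close> backwards. As \<open>g\<close> comes before the end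
  of \<open>p2\<close>, the induction applies to trails ending in the reversal of \<open>g\<close>.\<close>

lemma in_trail_to_reversal:
  assumes "rtrail (p1 @ a # p2)" "directable a" "\<forall>b\<in>set p2. \<not> directable b" "p2 \<noteq> []"
    and "rtrail q" "last q = reversal (last p2)"
  shows "a \<in> set q"
  using assms
proof (induction "length p2" arbitrary: p2 q rule: less_induct)
  case less
  show ?case
  proof (rule ccontr)
    assume a: "a \<notin> set q"
    have "edge (last q) \<in> edge ` set p2" using less.prems by simp
    then obtain q1 g q2 t1 t2 where q_eq: "q = q1 @ g # q2" and p2: "p2 = t1 @ g # t2"
      by (rule rtrail_merge[OF less.prems(1,5,2) a])
    \<comment> \<open>If \<open>g\<close> were last on \<open>p2\<close>, then \<open>q\<close>
      would contain \<open>g\<close> and end in its reversal; having distinct edges, it would force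
      \<open>g\<close> to equal its own reversal.\<close>
    have "t2 \<noteq> []"
    proof
      assume "t2 = []"
      then have "last q = reversal g" using less.prems p2 by simp
      then have "edge (last q) = edge g" by simp
      then have "q2 = []" using less.prems(5) q_eq
        by (cases q2 rule: rev_cases) (auto simp: rtrail_def)
      then have "g = reversal g" using \<open>last q = reversal g\<close> q_eq by simp
      then show False
        using reversal_neq rtrail_edges[OF less.prems(5)] q_eq by simp
    qed
    have IH: "a \<in> set s" if "rtrail s" "last s = reversal g" for s
      using less.hyps[of "t1 @ [g]" s] less.prems p2 that \<open>t2 \<noteq> []\<close>
        rtrail_prefix[of "p1 @ a # t1 @ [g]" t2] by simp
    have "\<not> directable g" "g \<in> oriented_edges B"
      using less.prems p2 by (auto simp: rtrail_def)
    then obtain s where s: "rtrail s" "last s = reversal g"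
      using undirectableE[of "reversal g"] by auto
    then have "a \<in> set s" using IH by blast
    then obtain s1 s2 where s_eq: "s = s1 @ a # s2" using split_list by fast
    have "s2 \<noteq> []"
    proof
      assume "s2 = []"
      then have "a = reversal g" using s s_eq by simp
      then show False using \<open>\<not> directable g\<close> less.prems(2) by simp
    qed
    then have "last s2 = reversal g" using s s_eq by simp
    then have "reversal g \<in> set s2" using \<open>s2 \<noteq> []\<close> last_in_set by fastforce
    \<comment> \<open>Merging the prefix of \<open>q\<close> that ends in \<open>g\<close> into
      \<open>s\<close> gives a trail that ends in the reversal of \<open>g\<close> but misses
      \<open>a\<close>, contradicting \<open>IH\<close>.\<close>
    then have m1: "edge (last (q1 @ [g])) \<in> edge ` set s2"
      by (metis image_eqI last_snoc reversal_simps(3))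
    have m2: "rtrail (q1 @ [g])" using less.prems(5) q_eq rtrail_prefix_last by simp
    have m3: "rtrail (s1 @ a # s2)" using s s_eq by simp
    have m4: "a \<notin> set (q1 @ [g])" using a q_eq by simp
    obtain u1 h u2 v1 v2 where uv: "q1 @ [g] = u1 @ h # u2" "s2 = v1 @ h # v2"
      "rtrail (u1 @ h # v2)"
      by (rule rtrail_merge[OF m3 m2 less.prems(2) m4 m1])
    have "last (u1 @ h # v2) = reversal g" using s s_eq uv(2) by simp
    then have "a \<in> set (u1 @ h # v2)" using IH uv(3) by blast
    moreover have "a \<notin> set (u1 @ [h])" using a q_eq arg_cong[OF uv(1), of set] by auto
    moreover have "a \<notin> set v2" using s s_eq uv(2) by (auto simp: rtrail_def)
    ultimately show False by auto
  qed
qed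


section \<open>Buds of undirectable edges\<close>

lemma rtrail_distinct: "rtrail p \<Longrightarrow> distinct p"
  by (simp add: rtrail_def distinct_map)

definition bud :: "('v, 'e) oriented_edge list \<Rightarrow> ('v, 'e) oriented_edge" where
  "bud p = last (filter directable p)"

lemma bud_append_Cons:
  assumes "directable a" "\<forall>b\<in>set p2. \<not> directable b"
  shows "bud (p1 @ a # p2) = a"
proof -
  have "filter directable p2 = []" using assms(2) by (simp add: filter_empty_conv)
  then show ?thesis using assms(1) by (simp add: bud_def)
qed

lemma bud_snoc: "\<not> directable b \<Longrightarrow> bud (p @ [b]) = bud p"
  by (simp add: bud_def)

text \<open>The first edge of a root trail is incident with \<open>r\<close> and hence directable,
  so \<open>bud\<close> never evaluates to \<open>last []\<close>.\<close>

lemma bud_split: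
  assumes "rtrail p"
  obtains p1 p2 where "p = p1 @ bud p # p2" "directable (bud p)" "\<forall>b\<in>set p2. \<not> directable b"
proof -
  have "hd p \<in> set p" "tail (hd p) = r" using assms by (simp_all add: rtrail_def)
  then have "\<exists>b\<in>set p. directable b"
    using directable_at_root rtrail_edges[OF assms] by blast
  then obtain p1 a p2 where p: "p = p1 @ a # p2" "directable a" "\<forall>b\<in>set p2. \<not> directable b"
    by (rule split_list_last_propE)
  then have "bud p = a" using bud_append_Cons by simp
  then show thesis using that[of p1 p2] p by simp
qed

text \<open>Trails to the reversal of \<open>last p\<close> contain the bud by
  \<open>in_trail_to_reversal\<close>. If \<open>q\<close> missed it, merging \<open>q\<close> into
  such a trail would produce another one that misses it too.\<close>

lemma bud_in_trail:
  assumes p: "rtrail p" "\<not> directable (last p)" and q: "rtrail q" "edge (last q) = edge (last p)"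
  shows "bud p \<in> set q"
proof (rule ccontr)
  assume a: "bud p \<notin> set q"
  obtain p1 p2 where split: "p = p1 @ bud p # p2" "directable (bud p)"
    "\<forall>b\<in>set p2. \<not> directable b"
    using p(1) by (rule bud_split)
  have "p2 \<noteq> []"
  proof
    assume "p2 = []"
    then have "last p = bud p" by (subst split(1)) simp
    then show False using p(2) split(2) by simp
  qed
  then have last_p2: "last p2 = last p" by (subst split(1)) simp
  have to_rev: "bud p \<in> set s" if "rtrail s" "last s = reversal (last p)" for s
    using in_trail_to_reversal[of p1 "bud p" p2 s] split p(1) \<open>p2 \<noteq> []\<close> last_p2 that by simp
  have "last p \<in> set p" "last q \<in> set q" using p(1) q(1) by (simp_all add: rtrail_def)
  then have mem: "last p \<in> oriented_edges B" "last q \<in> oriented_edges B"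
    using rtrail_edges p(1) q(1) by blast+
  obtain s where s: "rtrail s" "last s = reversal (last p)"
    by (rule undirectableE[of "reversal (last p)"]) (use p(2) mem in simp_all)
  obtain s1 s2 where s_eq: "s = s1 @ bud p # s2"
    using split_list[OF to_rev[OF s]] by blast
  have "s2 \<noteq> []"
  proof
    assume "s2 = []"
    then have "reversal (last p) = bud p" using s(2) s_eq by simp
    then show False using p(2) split(2) by (metis reversal_simps(3))
  qed
  then have "reversal (last p) = last s2" using s(2) s_eq by simp
  then have "reversal (last p) \<in> set s2" using \<open>s2 \<noteq> []\<close> by simp
  then have m1: "edge (last q) \<in> edge ` set s2"
    using q(2) by (metis image_eqI reversal_simps(3))
  have m2: "rtrail (s1 @ bud p # s2)" using s(1) s_eq by simp
  obtain q1 h q2 t1 t2 where ht: "q = q1 @ h # q2" "s2 = t1 @ h # t2" "rtrail (q1 @ h # t2)"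
    by (rule rtrail_merge[OF m2 q(1) split(2) a m1])
  have "last (q1 @ h # t2) = last s" using s_eq ht(2) by simp
  then have "bud p \<in> set (q1 @ h # t2)" using to_rev[OF ht(3)] s(2) by metis
  moreover have "bud p \<notin> set t2" using rtrail_distinct[OF m2] ht(2) by simp
  ultimately show False using a ht(1) by simp
qed

text \<open>The undirectable stretch after \<open>a\<close> can follow any trail ending in
  \<open>a\<close>: if it shared an edge with \<open>u\<close>, the prefix of \<open>u\<close>
  ending there would contain \<open>a\<close> by \<open>bud_in_trail\<close>, but \<open>a\<close>
  occurs only after \<open>u\<close>.\<close>

lemma bud_exchange:
  assumes u: "rtrail (u @ [a])" and w: "rtrail (w @ a # z)"
    and a: "directable a" and z: "\<forall>b\<in>set z. \<not> directable b"
  shows "rtrail (u @ a # z)"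
proof (cases "z = []")
  case True
  then show ?thesis using u by simp
next
  case False
  have disjoint: "edge b \<noteq> edge c" if "b \<in> set u" and c: "c \<in> set z" for b c
  proof
    assume bc: "edge b = edge c"
    obtain z1 z2 where "z = z1 @ c # z2" using split_list[OF c] by blast
    then have "rtrail ((w @ a # z1) @ [c])" "bud (w @ a # z1 @ [c]) = a"
      using rtrail_prefix_last[of "w @ a # z1" c z2] w bud_append_Cons[OF a, of "z1 @ [c]" w] z
      by simp_all
    moreover obtain u1 u2 where "u = u1 @ b # u2" using split_list[OF \<open>b \<in> set u\<close>] by blast
    moreover from this have "rtrail (u1 @ [b])" using rtrail_prefix_last[of u1 b "u2 @ [a]"] u by simp
    ultimately have "a \<in> set (u1 @ [b])"
      using bud_in_trail[of "w @ a # z1 @ [c]" "u1 @ [b]"] bc z c by simp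
    then show False using rtrail_distinct[OF u] \<open>u = u1 @ b # u2\<close> by auto
  qed
  have "rtrail ((u @ [a]) @ z)"
  proof (rule rtrail_append[OF u False])
    show "link B (last (u @ [a])) (hd z)" "successively (link B) z"
      using w False by (auto simp: rtrail_def successively_append_iff successively_Cons)
    show "set z \<subseteq> oriented_edges B" "distinct (map edge z)"
      using w by (auto simp: rtrail_def)
    have "edge a \<notin> edge ` set z" using w by (simp add: rtrail_def)
    then show "edge ` set (u @ [a]) \<inter> edge ` set z = {}" using disjoint by auto
    show "r \<notin> head ` set (butlast z)"
      using rtrail_head_neq_root[OF w] by (auto dest!: in_set_butlastD)
  qed
  then show ?thesis by simp
qed

text \<open>Each bud lies on the other trail. If they differ, \<open>bud q\<close> precedes
  \<open>bud p\<close> on \<open>p\<close>; leaving \<open>p\<close> at \<open>bud q\<close> and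
  following the end of \<open>q\<close> gives a trail to the same edge that misses
  \<open>bud p\<close>.\<close>

lemma bud_eq_of_same_edge:
  assumes p: "rtrail p" "\<not> directable (last p)" and q: "rtrail q" "edge (last q) = edge (last p)"
  shows "bud p = bud q"
proof (rule ccontr)
  assume neq: "bud p \<noteq> bud q"
  have last_q: "\<not> directable (last q)" using p(2) q(2) by simp
  obtain p1 p2 where ps: "p = p1 @ bud p # p2" "directable (bud p)" "\<forall>b\<in>set p2. \<not> directable b"
    using p(1) by (rule bud_split)
  obtain q1 q2 where qs: "q = q1 @ bud q # q2" "directable (bud q)" "\<forall>b\<in>set q2. \<not> directable b"
    using q(1) by (rule bud_split)
  have "bud q \<in> set p" using bud_in_trail[OF q(1) last_q p(1)] q(2) by simp
  then have "bud q \<in> set (p1 @ bud p # p2)" using ps(1) by simp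
  then have "bud q \<in> set p1" using neq ps(3) qs(2) by auto
  then obtain u v where u: "p1 = u @ bud q # v" using split_list by fast
  have "rtrail (u @ bud q # v @ bud p # p2)" using p(1) ps(1) u by simp
  then have "rtrail (u @ [bud q])" by (rule rtrail_prefix_last)
  moreover have "rtrail (q1 @ bud q # q2)" using q(1) qs(1) by simp
  ultimately have r: "rtrail (u @ bud q # q2)" using bud_exchange qs(2,3) by blast
  have "q2 \<noteq> []"
  proof
    assume "q2 = []"
    then have "last q = bud q" by (subst qs(1)) simp
    then show False using last_q qs(2) by simp
  qed
  then have "last (u @ bud q # q2) = last q" by (subst (2) qs(1)) simp
  then have "bud p \<in> set (u @ bud q # q2)" using bud_in_trail[OF p r] q(2) by simp
  moreover have "bud p \<notin> set u"
  proof -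
    have "distinct (u @ bud q # v @ bud p # p2)" using rtrail_distinct[OF p(1)] ps(1) u by simp
    then show ?thesis by simp
  qed
  ultimately show False using neq ps(2) qs(3) by auto
qed


section \<open>Buds of trails ending in the same vertex\<close>

lemma last_edge_fresh:
  assumes "rtrail (u @ v)" "v \<noteq> []"
  shows "edge (last (u @ v)) \<notin> edge ` set u"
proof -
  have "last (u @ v) \<in> set v" using assms(2) by simp
  then have "edge (last (u @ v)) \<in> edge ` set v" by (rule imageI)
  moreover have "edge ` set u \<inter> edge ` set v = {}" using assms(1) by (simp add: rtrail_def)
  ultimately show ?thesis by blast
qed

text \<open>Opposite signs allow each last edge to be followed by the reversal of the other. If
  \<open>p\<close> can be so extended, both trails end in the same undirectable edge up to
  direction, and \<open>bud_eq_of_same_edge\<close> applies. The obstacle is that \<open>p\<close>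
  may already use that edge.\<close>

lemma bud_eq_of_opposite_signs:
  assumes p: "rtrail p" and q: "rtrail q" "\<not> directable (last q)"
    and heads: "head (last p) = head (last q)"
    and signs: "sign_of B (edge (last p)) (head (last q)) \<noteq> sign_of B (edge (last q)) (head (last q))"
  shows "bud p = bud q"
proof -
  let ?f = "last q" and ?g = "last p"
  have links: "link B ?g (reversal ?f)" "link B ?f (reversal ?g)"
    using heads neq_imp_opposite[OF signs] by (simp_all add: link_def)
  have "?f \<in> set q" "?g \<in> set p" using p q(1) by (simp_all add: rtrail_def)
  then have mem: "?f \<in> oriented_edges B" "?g \<in> oriented_edges B"
    using rtrail_edges p q(1) by blast+
  show ?thesis
  proof (cases "edge ?f \<in> edge ` set p")
    case False
    then have "rtrail (p @ [reversal ?f])"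
      using rtrail_snoc[OF p links(1)] mem by simp
    then have "bud q = bud (p @ [reversal ?f])"
      using bud_eq_of_same_edge[OF q, of "p @ [reversal ?f]"] by simp
    then show ?thesis using bud_snoc q(2) by simp
  next
    case True
    then obtain b where b: "b \<in> set p" "edge b = edge ?f" by force
    obtain u w where uw: "p = u @ b # w" "rtrail (u @ [b])" by (rule rtrail_split[OF p b(1)])
    have bud_u: "bud (u @ [b]) = bud q"
      using bud_eq_of_same_edge[OF q uw(2)] b(2) by simp
    have "w \<noteq> []"
    proof
      assume "w = []"
      then have "edge ?g = edge ?f" using uw(1) b(2) by simp
      then show False using signs by simp
    qed
    then have g_u: "edge ?g \<notin> edge ` set (u @ [b])"
      using last_edge_fresh[of "u @ [b]" w] p uw(1) by simp
    obtain u1 u2 where "u @ [b] = u1 @ bud (u @ [b]) # u2"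
      using uw(2) by (rule bud_split)
    then have us: "u @ [b] = u1 @ bud q # u2" by (simp only: bud_u)
    have ru1: "rtrail (u1 @ [bud q])"
      using uw(2) unfolding us by (rule rtrail_prefix_last)
    obtain q1 q2 where qs: "q = q1 @ bud q # q2" "directable (bud q)"
      "\<forall>b\<in>set q2. \<not> directable b"
      using q(1) by (rule bud_split)
    have rq: "rtrail (q1 @ bud q # q2)" using q(1) qs(1) by simp
    \<comment> \<open>A detour: \<open>p\<close> up to \<open>bud q\<close>, then the end of
      \<open>q\<close>. It ends in \<open>?f\<close> and is to be extended by the reversal of
      \<open>?g\<close>, which is possible unless \<open>q2\<close> uses the edge of
      \<open>?g\<close>.\<close>
    have r: "rtrail (u1 @ bud q # q2)" by (rule bud_exchange[OF ru1 rq qs(2,3)])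
    have "q2 \<noteq> []"
    proof
      assume "q2 = []"
      then have "?f = bud q" by (subst qs(1)) simp
      then show False using q(2) qs(2) by simp
    qed
    then have last_r: "last (u1 @ bud q # q2) = ?f" by (subst (2) qs(1)) simp
    show ?thesis
    proof (cases "edge ?g \<in> edge ` set q2")
      case True
      then obtain c where c: "c \<in> set q2" "edge c = edge ?g" by force
      then obtain z1 z2 where z: "q2 = z1 @ c # z2" using split_list by fast
      have "rtrail ((q1 @ bud q # z1) @ c # z2)" using rq by (simp add: z)
      then have rc: "rtrail (q1 @ bud q # z1 @ [c])"
        using rtrail_prefix_last[of "q1 @ bud q # z1" c z2] by simp
      have "bud (q1 @ bud q # z1 @ [c]) = bud q"
        using bud_append_Cons[OF qs(2), of "z1 @ [c]"] qs(3) by (simp add: z)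
      moreover have "bud (q1 @ bud q # z1 @ [c]) = bud p"
      proof (rule bud_eq_of_same_edge[OF rc _ p])
        show "\<not> directable (last (q1 @ bud q # z1 @ [c]))" using qs(3) c(1) by simp
        show "edge ?g = edge (last (q1 @ bud q # z1 @ [c]))" using c(2) by simp
      qed
      ultimately show ?thesis by simp
    next
      case False
      have "edge ` set (u1 @ [bud q]) \<subseteq> edge ` set (u @ [b])" unfolding us by auto
      then have "edge ?g \<notin> edge ` set (u1 @ [bud q])" using g_u by blast
      then have "edge ?g \<notin> edge ` set (u1 @ bud q # q2)" using False by (simp add: image_Un)
      then have r': "rtrail ((u1 @ bud q # q2) @ [reversal ?g])"
        using rtrail_snoc[OF r, of "reversal ?g"] links(2) mem last_r by simp
      \<comment> \<open>The extended detour and \<open>p\<close> traverse \<open>?g\<close> in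
        opposite directions.\<close>
      have nd: "\<not> directable ?g" using undirectableI[OF p r'] by simp
      then have "bud p = bud ((u1 @ bud q # q2) @ [reversal ?g])"
        using bud_eq_of_same_edge[OF p _ r'] by simp
      also have "\<dots> = bud (u1 @ bud q # q2)" by (rule bud_snoc) (simp add: nd)
      also have "\<dots> = bud q" using bud_append_Cons[OF qs(2,3)] .
      finally show ?thesis .
    qed
  qed
qed

text \<open>For equal signs, take a trail to the reversal of \<open>last q\<close>. Its penultimate
  edge \<open>?d\<close> enters the common vertex with the opposite sign, so the previous lemma
  compares \<open>q\<close>, and if possible \<open>p\<close>, with the trail ending in
  \<open>?d\<close>.\<close>

lemma bud_eq_of_same_head:
  assumes p: "rtrail p" and q: "rtrail q" "\<not> directable (last q)"
    and heads: "head (last p) = head (last q)"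
  shows "bud p = bud q"
proof -
  let ?f = "last q" and ?g = "last p"
  consider "edge ?g = edge ?f" |
    "sign_of B (edge ?g) (head ?f) \<noteq> sign_of B (edge ?f) (head ?f)" |
    "edge ?g \<noteq> edge ?f" "sign_of B (edge ?g) (head ?f) = sign_of B (edge ?f) (head ?f)"
    by blast
  then show ?thesis
  proof cases
    case 1
    then show ?thesis using bud_eq_of_same_edge[OF q p] by simp
  next
    case 2
    then show ?thesis by (rule bud_eq_of_opposite_signs[OF p q heads])
  next
    case 3
    have "?f \<in> set q" "?g \<in> set p" using p q(1) by (simp_all add: rtrail_def)
    then have mem: "?f \<in> oriented_edges B" "?g \<in> oriented_edges B" and "head ?f \<noteq> r"
      using rtrail_edges rtrail_head_neq_root p q(1) by blast+
    obtain w where w: "rtrail w" "last w = reversal ?f"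
      by (rule undirectableE[of "reversal ?f"]) (use q(2) mem in simp_all)
    define w' where "w' = butlast w"
    have w_eq: "w = w' @ [reversal ?f]"
      using append_butlast_last_id[of w] w by (simp add: w'_def rtrail_def)
    have "w' \<noteq> []"
    proof
      assume "w' = []"
      then have "head ?f = r" using w(1) w_eq by (simp add: rtrail_def)
      then show False using \<open>head ?f \<noteq> r\<close> by simp
    qed
    let ?d = "last w'"
    have w': "rtrail w'" using w(1) w_eq rtrail_prefix \<open>w' \<noteq> []\<close> by simp
    have link: "link B ?d (reversal ?f)"
      using rtrail_tail(1)[of w' "reversal ?f" "[]"] w(1) w_eq \<open>w' \<noteq> []\<close> by simp
    then have "head ?d = head ?f" by (simp add: link_def)
    moreover from this link
    have "sign_of B (edge ?f) (head ?f) = opposite (sign_of B (edge ?d) (head ?f))"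
      by (simp add: link_def)
    ultimately have d: "head ?d = head ?f"
      "sign_of B (edge ?f) (head ?f) = opposite (sign_of B (edge ?d) (head ?f))" .
    then have bud_w': "bud w' = bud q"
      by (intro bud_eq_of_opposite_signs[OF w' q]) simp_all
    show ?thesis
    proof (cases "directable ?d")
      case False
      have "bud p = bud w'"
        using bud_eq_of_opposite_signs[OF p w' False] heads d 3 by simp
      then show ?thesis using bud_w' by simp
    next
      case True
      have "?d \<in> set w'" using \<open>w' \<noteq> []\<close> by simp
      then have d_mem: "?d \<in> oriented_edges B" using rtrail_edges w' by blast
      have "bud (butlast w' @ [?d]) = ?d" using bud_append_Cons[OF True, of "[]"] by simp
      \<comment> \<open>With \<open>?d\<close> directable, the bud is \<open>?d\<close> itself. It
        lies on \<open>p\<close>, since otherwise extending \<open>p\<close> by its reversal would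
        make \<open>?d\<close> undirectable.\<close>
      then have bud_q: "bud q = ?d" using bud_w' \<open>w' \<noteq> []\<close> by simp
      have links: "link B ?g (reversal ?d)" "link B ?d (reversal ?g)"
        using heads d 3(2) by (simp_all add: link_def)
      have "?d \<in> set p"
      proof (rule ccontr)
        assume "?d \<notin> set p"
        then have "edge ?d \<notin> edge ` set p"
          using directable_same_orientation[OF w' p \<open>?d \<in> set w'\<close> _ _ True] by force
        then have "rtrail (p @ [reversal ?d])"
          using rtrail_snoc[OF p links(1)] d_mem by simp
        then show False using undirectableI[OF w', of "p @ [reversal ?d]"] True by simp
      qed
      then obtain u v where uv: "p = u @ ?d # v" "rtrail (u @ [?d])" by (rule rtrail_split[OF p])
      have "v \<noteq> []"
      proof
        assume "v = []"
        then have "?g = ?d" by (subst uv(1)) simp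
        then show False using 3(2) d by simp
      qed
      then have "edge ?g \<notin> edge ` set (u @ [?d])"
        using last_edge_fresh[of "u @ [?d]" v] p uv(1) by simp
      \<comment> \<open>Turning from \<open>?d\<close> back along \<open>?g\<close> shows that
        \<open>?g\<close> is undirectable with bud \<open>?d\<close>.\<close>
      then have r: "rtrail ((u @ [?d]) @ [reversal ?g])"
        using rtrail_snoc[OF uv(2), of "reversal ?g"] links(2) mem by simp
      have nd: "\<not> directable ?g" using undirectableI[OF p r] by simp
      then have "bud p = bud ((u @ [?d]) @ [reversal ?g])"
        using bud_eq_of_same_edge[OF p _ r] by simp
      also have "\<dots> = ?d" using bud_append_Cons[OF True, of "[reversal ?g]" u] nd by simp
      finally show ?thesis using bud_q by simp
    qed
  qed
qed

lemma bud_in_set: "rtrail p \<Longrightarrow> bud p \<in> set p"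
  by (erule bud_split) (metis in_set_conv_decomp)

lemma bud_after_directable:
  assumes "directable a"
  shows "bud (u @ a # v) \<in> set (a # v)"
proof -
  have "bud (u @ a # v) = last (a # filter directable v)" using assms by (simp add: bud_def)
  also have "\<dots> \<in> set (a # filter directable v)" by (rule last_in_set) simp
  finally show ?thesis by auto
qed

text \<open>As \<open>x\<close> differs from \<open>r\<close>, the trivial path is excluded;
  \<open>rtrail_head_neq_root\<close> already keeps \<open>r\<close> from being repeated.\<close>

lemma path_iff:
  assumes "x \<noteq> r"
  shows "path B r p x \<longleftrightarrow> rtrail p \<and> distinct (map head p) \<and> head (last p) = x"
proof (cases "p = []")
  case True
  then show ?thesis using assms by (simp add: path_def trail_def trail_verts_def rtrail_def)
next
  case False
  have "r \<notin> set (map head p)" if "rtrail p"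
    using rtrail_head_neq_root[OF that] by auto
  moreover have "set (butlast (map head p)) \<subseteq> set (map head p)" by (blast dest: in_set_butlastD)
  ultimately show ?thesis
    using root_vert False
    unfolding path_def trail_iff[OF False] trail_verts_def rtrail_def distinct.simps(2)
    by blast
qed


end

section \<open>Preferences defined by two path systems\<close>

locale two_path_systems = edge_clean_graph B r
  for B :: "('v, 'e) bidirected_graph" and r :: 'v +
  fixes x :: 'v and P Q :: "('v, 'e) oriented_edge list set"
  assumes x_neq: "x \<noteq> r"
    and P: "edge_disjoint_paths B r x P" and Q: "edge_disjoint_paths B r x Q"
begin

lemma
  assumes "p \<in> P \<union> Q"
  shows system_rtrail: "rtrail p" and system_distinct_heads: "distinct (map head p)"
    and system_end: "head (last p) = x" and system_distinct: "distinct p"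
proof -
  have "path B r p x" using assms P Q by (auto simp: edge_disjoint_paths_def)
  then show "rtrail p" "distinct (map head p)" "head (last p) = x" "distinct p"
    using path_iff[OF x_neq] by (auto simp: rtrail_distinct)
qed

lemma P_unique:
  assumes "p \<in> P" "p' \<in> P" "b \<in> set p" "c \<in> set p'" "edge b = edge c"
  shows "p = p'"
proof (rule ccontr)
  assume "p \<noteq> p'"
  then have "edge ` set p \<inter> edge ` set p' = {}"
    using P assms(1,2) unfolding edge_disjoint_paths_def pairwise_def edge_disjoint_def by blast
  moreover have "edge b \<in> edge ` set p" using assms(3) by (rule imageI)
  moreover have "edge b \<in> edge ` set p'" unfolding assms(5) using assms(4) by (rule imageI)
  ultimately show False by blast
qed

lemma Q_unique:
  assumes "q \<in> Q" "q' \<in> Q" "b \<in> set q" "c \<in> set q'" "edge b = edge c"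
  shows "q = q'"
proof -
  \<comment> \<open>The hypotheses are symmetric in \<open>P\<close> and \<open>Q\<close>.\<close>
  interpret swap: two_path_systems B r x Q P using x_neq P Q by unfold_locales
  show ?thesis by (rule swap.P_unique[OF assms])
qed

definition common :: "('v, 'e) oriented_edge set" where
  "common = {a. directable a \<and> (\<exists>p\<in>P. a \<in> set p) \<and> (\<exists>q\<in>Q. a \<in> set q)}"

lemma commonI:
  "\<lbrakk>directable a; p \<in> P; q \<in> Q; a \<in> set p; a \<in> set q\<rbrakk> \<Longrightarrow> a \<in> common"
  unfolding common_def by blast

text \<open>In both \<open>earlier\<close> and \<open>later\<close> the preferred edge is the first
  argument, as in \<open>stable_set_exists\<close>.\<close>

definition earlier :: "('v, 'e) oriented_edge \<Rightarrow> ('v, 'e) oriented_edge \<Rightarrow> bool" where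
  "earlier a b \<longleftrightarrow> (\<exists>p\<in>P. \<exists>u v. p = u @ b # v \<and> a \<in> set u)"

definition later :: "('v, 'e) oriented_edge \<Rightarrow> ('v, 'e) oriented_edge \<Rightarrow> bool" where
  "later a b \<longleftrightarrow> (\<exists>q\<in>Q. \<exists>u v. q = u @ b # v \<and> a \<in> set v)"

lemma earlierI: "u @ b # v \<in> P \<Longrightarrow> a \<in> set u \<Longrightarrow> earlier a b"
  unfolding earlier_def by blast

lemma laterI: "u @ b # v \<in> Q \<Longrightarrow> a \<in> set v \<Longrightarrow> later a b"
  unfolding later_def by blast

text \<open>By edge-disjointness only one path of \<open>P\<close> contains \<open>b\<close>, and
  only once, so every split at \<open>b\<close> is the same.\<close>

lemma earlierD:
  assumes "earlier a b" "u @ b # v \<in> P"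
  shows "a \<in> set u"
proof -
  obtain u' v' where p': "u' @ b # v' \<in> P" "a \<in> set u'"
    using assms(1) unfolding earlier_def by blast
  have "u @ b # v = u' @ b # v'" using P_unique[OF assms(2) p'(1), of b b] by simp
  moreover have "distinct (u @ b # v)" using system_distinct assms(2) by blast
  ultimately show ?thesis using distinct_split_unique p'(2) by metis
qed

lemma laterD:
  assumes "later a b" "u @ b # v \<in> Q"
  shows "a \<in> set v"
proof -
  obtain u' v' where q': "u' @ b # v' \<in> Q" "a \<in> set v'"
    using assms(1) unfolding later_def by blast
  have "u @ b # v = u' @ b # v'" using Q_unique[OF assms(2) q'(1), of b b] by simp
  moreover have "distinct (u @ b # v)" using system_distinct assms(2) by blast
  ultimately show ?thesis using distinct_split_unique q'(2) by metis
qed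

lemma earlier_transp: "transp earlier"
proof (rule transpI)
  fix a b c assume ab: "earlier a b" and bc: "earlier b c"
  obtain u v where p: "u @ c # v \<in> P" "b \<in> set u" using bc unfolding earlier_def by blast
  obtain u1 u2 where u: "u = u1 @ b # u2" using split_list[OF p(2)] by blast
  have "a \<in> set u1" using earlierD[OF ab, of u1 "u2 @ c # v"] p(1) u by simp
  then have "a \<in> set u" using u by simp
  then show "earlier a c" using earlierI p(1) by blast
qed

lemma later_transp: "transp later"
proof (rule transpI)
  fix a b c assume ab: "later a b" and bc: "later b c"
  obtain u v where q: "u @ c # v \<in> Q" "b \<in> set v" using bc unfolding later_def by blast
  obtain v1 v2 where v: "v = v1 @ b # v2" using split_list[OF q(2)] by blast
  have "a \<in> set v2" using laterD[OF ab, of "u @ c # v1" v2] q(1) v by simp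
  then have "a \<in> set v" using v by simp
  then show "later a c" using laterI q(1) by blast
qed

lemma earlier_irreflp: "irreflp earlier"
proof (rule irreflpI)
  show "\<not> earlier a a" for a
    unfolding earlier_def using system_distinct by fastforce
qed

lemma later_irreflp: "irreflp later"
proof (rule irreflpI)
  show "\<not> later a a" for a
    unfolding later_def using system_distinct by fastforce
qed

lemma finite_common: "finite common"
proof (rule finite_subset[OF _ finite_oriented_edges[OF finite_graph]])
  show "common \<subseteq> oriented_edges B"
    unfolding common_def using system_rtrail rtrail_edges by blast
qed

end

section \<open>A stable set of switching edges\<close>

locale stable_switches = two_path_systems B r x P Q
  for B :: "('v, 'e) bidirected_graph" and r x :: 'v and P Q +
  fixes S :: "('v, 'e) oriented_edge set"
  assumes S_common: "S \<subseteq> common"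
    and S_indep: "\<lbrakk>s \<in> S; t \<in> S\<rbrakk> \<Longrightarrow> \<not> earlier s t \<and> \<not> later s t"
    and S_stable: "\<lbrakk>e \<in> common; e \<notin> S\<rbrakk> \<Longrightarrow> \<exists>s\<in>S. earlier s e \<or> later s e"
begin

text \<open>Distinct edges on one path of \<open>P\<close> are comparable under
  \<open>earlier\<close>, so independence allows at most one switch per path.\<close>

lemma S_unique_P:
  assumes "s \<in> S" "t \<in> S" "p \<in> P" "s \<in> set p" "t \<in> set p"
  shows "s = t"
proof (rule ccontr)
  assume "s \<noteq> t"
  obtain u v where p: "p = u @ s # v" using split_list[OF assms(4)] by blast
  then consider "t \<in> set u" | "t \<in> set v" using assms(5) \<open>s \<noteq> t\<close> by auto
  then show False
  proof cases
    case 1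
    then have "earlier t s" using earlierI assms(3) p by simp
    then show False using S_indep assms(1,2) by blast
  next
    case 2
    then obtain v1 v2 where "v = v1 @ t # v2" using split_list by fast
    then have "(u @ s # v1) @ t # v2 \<in> P" using p assms(3) by simp
    then have "earlier s t" by (rule earlierI) simp
    then show False using S_indep assms(1,2) by blast
  qed
qed

lemma S_unique_Q:
  assumes "s \<in> S" "t \<in> S" "q \<in> Q" "s \<in> set q" "t \<in> set q"
  shows "s = t"
proof (rule ccontr)
  assume "s \<noteq> t"
  obtain u v where q: "q = u @ s # v" using split_list[OF assms(4)] by blast
  then consider "t \<in> set u" | "t \<in> set v" using assms(5) \<open>s \<noteq> t\<close> by auto
  then show False
  proof cases
    case 1
    then obtain u1 u2 where "u = u1 @ t # u2" using split_list by fast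
    then have "u1 @ t # (u2 @ s # v) \<in> Q" using q assms(3) by simp
    then have "later s t" by (rule laterI) simp
    then show False using S_indep assms(1,2) by blast
  next
    case 2
    then have "later t s" using laterI assms(3) q by simp
    then show False using S_indep assms(1,2) by blast
  qed
qed

text \<open>This is what makes the new paths edge-disjoint. A directable common edge outside
  \<open>S\<close> would be beaten by a switch before it on the \<open>P\<close>-path or after it on
  the \<open>Q\<close>-path, and there is none. For an undirectable edge the same argument is
  applied to its bud.\<close>

lemma initial_meets_terminal:
  assumes p: "u @ b # u' \<in> P" "set u \<inter> S = {}"
    and q: "w @ c # w' \<in> Q" "set w' \<inter> S = {}"
    and bc: "edge b = edge c"
  shows "b = c \<and> b \<in> S"
proof (cases "directable b")
  case True
  have rp: "rtrail (u @ b # u')" and rq: "rtrail (w @ c # w')" using system_rtrail p q by blast+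
  have "b = c" using directable_same_orientation[OF rp rq _ _ bc True] by simp
  moreover have "b \<in> S"
  proof (rule ccontr)
    assume "b \<notin> S"
    moreover have "b \<in> common"
      using commonI[OF True, of "u @ b # u'" "w @ c # w'"] p(1) q(1) \<open>b = c\<close> by simp
    ultimately obtain s where s: "s \<in> S" "earlier s b \<or> later s b" using S_stable by blast
    from s(2) show False
    proof
      assume "earlier s b"
      then have "s \<in> set u" using earlierD p(1) by blast
      then show False using p(2) s(1) by blast
    next
      assume "later s b"
      then have "s \<in> set w'" using laterD q(1) \<open>b = c\<close> by blast
      then show False using q(2) s(1) by blast
    qed
  qed
  ultimately show ?thesis by blast
next
  case False
  have "rtrail (u @ b # u')" "rtrail (w @ c # w')" using system_rtrail p q by blast+
  then have rp: "rtrail (u @ [b])" and rq: "rtrail (w @ [c])"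
    using rtrail_prefix_last by blast+
  have c: "\<not> directable c" using False bc by simp
  let ?a = "bud (u @ [b])"
  have a: "bud (w @ [c]) = ?a" using bud_eq_of_same_edge[OF rp _ rq] False bc by simp
  have dir: "directable ?a" using rp by (rule bud_split)
  have "?a \<in> set (u @ [b])" using bud_in_set[OF rp] .
  then have "?a \<in> set u" using dir False by auto
  then obtain u1 u2 where u: "u = u1 @ ?a # u2" using split_list by fast
  obtain y z where "w @ [c] = y @ bud (w @ [c]) # z" and z: "\<forall>d\<in>set z. \<not> directable d"
    using rq by (rule bud_split)
  then have yz: "w @ [c] = y @ ?a # z" by (simp only: a)
  have "w @ c # w' = (w @ [c]) @ w'" by simp
  also have "\<dots> = y @ ?a # (z @ w')" unfolding yz by simp
  finally have q': "y @ ?a # (z @ w') \<in> Q" using q(1) by metis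
  have p': "u1 @ ?a # (u2 @ b # u') \<in> P" using p(1) by (subst (asm) u) simp
  have "?a \<in> common" by (rule commonI[OF dir p' q']) simp_all
  \<comment> \<open>The bud precedes \<open>b\<close> on the \<open>P\<close>-path, where no switch
    lies.\<close>
  moreover have "?a \<notin> S" using \<open>?a \<in> set u\<close> p(2) by blast
  ultimately obtain s where s: "s \<in> S" "earlier s ?a \<or> later s ?a" using S_stable by blast
  from s(2) have False
  proof
    assume "earlier s ?a"
    then have "s \<in> set u1" using p' by (rule earlierD)
    then have "s \<in> set u" by (subst u) simp
    then show False using p(2) s(1) by blast
  next
    assume "later s ?a"
    \<comment> \<open>Between the bud and \<open>c\<close> all edges are undirectable, so a later
      switch would have to lie in \<open>w'\<close>.\<close>
    then have "s \<in> set (z @ w')" using q' by (rule laterD)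
    moreover have "directable s" using s(1) S_common by (auto simp: common_def)
    ultimately show False using z q(2) s(1) by auto
  qed
  then show ?thesis ..
qed

text \<open>On a path of \<open>P\<close> this stretch includes the switch itself, or is the whole
  path if there is no switch; likewise for \<open>terminal\<close> on a path of
  \<open>Q\<close>.\<close>

definition initial :: "('v, 'e) oriented_edge list \<Rightarrow> ('v, 'e) oriented_edge set" where
  "initial p = {b. \<exists>u v. p = u @ b # v \<and> set u \<inter> S = {}}"

definition terminal :: "('v, 'e) oriented_edge list \<Rightarrow> ('v, 'e) oriented_edge set" where
  "terminal q = {c. \<exists>u v. q = u @ c # v \<and> set v \<inter> S = {}}"

lemma initial_subset: "initial p \<subseteq> set p" and terminal_subset: "terminal p \<subseteq> set p"
  by (auto simp: initial_def terminal_def)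

lemma initial_all:
  assumes "set p \<inter> S = {}"
  shows "set p \<subseteq> initial p"
proof
  fix b assume "b \<in> set p"
  then obtain u v where "p = u @ b # v" using split_list by fast
  moreover from this have "set u \<inter> S = {}" using assms by auto
  ultimately show "b \<in> initial p" unfolding initial_def by blast
qed

lemma terminal_all:
  assumes "set q \<inter> S = {}"
  shows "set q \<subseteq> terminal q"
proof
  fix b assume "b \<in> set q"
  then obtain u v where "q = u @ b # v" using split_list by fast
  moreover from this have "set v \<inter> S = {}" using assms by auto
  ultimately show "b \<in> terminal q" unfolding terminal_def by blast
qed

lemma initial_terminal:
  assumes "p \<in> P" "q \<in> Q" "b \<in> initial p" "c \<in> terminal q" "edge b = edge c"
  shows "b = c \<and> b \<in> S"
  using assms initial_meets_terminal unfolding initial_def terminal_def by blast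

section \<open>Switching from one path to another\<close>

text \<open>Following \<open>p\<close> through \<open>e\<close> and then \<open>q\<close> may repeat
  vertices. Hence \<open>p\<close> is left at the first vertex that is the head of \<open>e\<close>
  or of a later edge of \<open>q\<close>. The switch is charged to \<open>initial p\<close>, which
  is why \<open>S\<close> is removed from \<open>terminal q\<close>.\<close>

lemma splice:
  assumes p: "p \<in> P" and q: "q \<in> Q" and e: "e \<in> S" "e \<in> set p" "e \<in> set q"
  obtains R where "path B r R x" "edge (hd p) \<in> edge ` set R" "edge (last q) \<in> edge ` set R"
    "set R \<subseteq> initial p \<union> (terminal q - S)"
proof -
  have rp: "rtrail p" and rq: "rtrail q" and hp: "distinct (map head p)"
    and hq: "distinct (map head q)" and xp: "head (last p) = x" and xq: "head (last q) = x"
    and dp: "distinct p" and dq: "distinct q"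
    using system_rtrail[of p] system_distinct_heads[of p] system_end[of p] system_distinct[of p]
      system_rtrail[of q] system_distinct_heads[of q] system_end[of q] system_distinct[of q] p q
    by simp_all
  have e_dir: "directable e" using e(1) S_common by (auto simp: common_def)
  obtain u u' where p_eq: "p = u @ e # u'" using split_list[OF e(2)] by blast
  obtain w w' where q_eq: "q = w @ e # w'" using split_list[OF e(3)] by blast
  have e_notin: "e \<notin> set u" "e \<notin> set u'" "e \<notin> set w'" using dp dq p_eq q_eq by simp_all
  have "set u \<subseteq> set p" "set w' \<subseteq> set q" using p_eq q_eq by auto
  then have uS: "set u \<inter> S = {}" and wS: "set w' \<inter> S = {}"
    using S_unique_P[OF _ e(1) p _ e(2)] S_unique_Q[OF _ e(1) q _ e(3)] e_notin by blast+
  have ini: "set (u @ [e]) \<subseteq> initial p"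
  proof
    fix b assume b: "b \<in> set (u @ [e])"
    obtain u1 u2 where us: "u @ [e] = u1 @ b # u2" using split_list[OF b] by blast
    have "p = (u @ [e]) @ u'" using p_eq by simp
    also have "\<dots> = u1 @ b # (u2 @ u')" unfolding us by simp
    finally have "p = u1 @ b # (u2 @ u')" .
    moreover have "set u1 \<subseteq> set u"
      using arg_cong[OF us, of butlast] by (auto simp: butlast_append)
    ultimately show "b \<in> initial p" using uS unfolding initial_def by blast
  qed
  have ter: "set w' \<subseteq> terminal q - S"
  proof
    fix c assume c: "c \<in> set w'"
    obtain w1 w2 where ws: "w' = w1 @ c # w2" using split_list[OF c] by blast
    have "q = (w @ e # w1) @ c # w2" using q_eq ws by simp
    moreover have "set w2 \<inter> S = {}" using wS ws by auto
    ultimately have "c \<in> terminal q" unfolding terminal_def by blast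
    then show "c \<in> terminal q - S" using c wS by blast
  qed
  have fresh: "edge b \<noteq> edge c" if "b \<in> set (u @ [e])" "c \<in> set w'" for b c
    using initial_terminal[OF p q, of b c] that ini ter by blast
  \<comment> \<open>Equal signs let \<open>b\<close> take the place of \<open>c\<close> on
    \<open>q\<close>. If they differed, turning back along \<open>c\<close> would make
    \<open>c\<close> undirectable, and the two trails would have a common bud. By
    \<open>fresh\<close> that bud can only be \<open>e\<close>; then \<open>b = e\<close>, so
    \<open>q\<close> would visit \<open>head e\<close> twice.\<close>
  have same_sign: "sign_of B (edge b) (head b) = sign_of B (edge c) (head b)"
    if b: "b \<in> set (u @ [e])" and c: "c \<in> set (e # w')" and bc: "head b = head c" for b c
  proof (cases "c = e")
    case True
    have "b \<in> set p" using b p_eq by auto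
    then have "b = e" using hp e(2) bc True by (simp add: distinct_map inj_on_def)
    then show ?thesis using True by simp
  next
    case False
    then have c': "c \<in> set w'" using c by simp
    show ?thesis
    proof (rule ccontr)
      assume signs: "sign_of B (edge b) (head b) \<noteq> sign_of B (edge c) (head b)"
      obtain u1 u2 where us: "u @ [e] = u1 @ b # u2" using split_list[OF b] by blast
      obtain w1 w2 where ws: "w' = w1 @ c # w2" using split_list[OF c'] by blast
      have "rtrail ((u @ [e]) @ u')" using rp p_eq by simp
      then have "rtrail (u1 @ b # (u2 @ u'))" unfolding us by simp
      then have rb: "rtrail (u1 @ [b])" by (rule rtrail_prefix_last)
      have "rtrail ((w @ e # w1) @ c # w2)" using rq q_eq ws by simp
      then have rc: "rtrail ((w @ e # w1) @ [c])" by (rule rtrail_prefix_last)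
      have sub: "set (u1 @ [b]) \<subseteq> set (u @ [e])" unfolding us by auto
      have "edge c \<notin> edge ` set (u1 @ [b])" using fresh[OF _ c'] sub by fastforce
      moreover have "link B b (reversal c)"
        using bc neq_imp_opposite[OF signs[symmetric]] by (simp add: link_def)
      moreover have "c \<in> oriented_edges B" using rtrail_edges[OF rc] by simp
      ultimately have "rtrail ((u1 @ [b]) @ [reversal c])"
        using rtrail_snoc[OF rb, of "reversal c"] by simp
      then have c_nd: "\<not> directable c" using undirectableI[OF rc] by simp
      let ?a = "bud (u1 @ [b])"
      have "bud (u1 @ [b]) = bud ((w @ e # w1) @ [c])"
        using bud_eq_of_same_head[OF rb rc] c_nd bc by simp
      also have "\<dots> = bud (w @ e # w1)" by (rule bud_snoc) (rule c_nd)
      finally have "?a \<in> set (e # w1)" using bud_after_directable[OF e_dir] by simp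
      moreover have a_mem: "?a \<in> set (u1 @ [b])" using rb by (rule bud_in_set)
      moreover have "?a \<notin> set w'" using fresh[of ?a ?a] a_mem sub by blast
      ultimately have "?a = e" using ws by auto
      then have e_mem: "e \<in> set (u1 @ [b])" using a_mem by simp
      have "b = e"
      proof (cases "u2 = []")
        case True
        then show ?thesis using us by simp
      next
        case False
        have "last (u @ [e]) = last (u1 @ b # u2)" by (simp only: us)
        then have "e = last u2" using False by simp
        then have "e \<in> set u2" using False by simp
        moreover have "distinct (u @ [e])" using dp p_eq by simp
        then have "distinct ((u1 @ [b]) @ u2)" unfolding us by simp
        ultimately show ?thesis using e_mem by auto
      qed
      then have "head e = head c" "c \<in> set q" using bc c' q_eq by auto
      then have "e = c" using hq e(3) by (simp add: distinct_map inj_on_def)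
      then show False using False by simp
    qed
  qed
  \<comment> \<open>The edge \<open>e\<close> itself is such an edge, so a first one exists.\<close>
  have "\<exists>b\<in>set (u @ [e]). head b \<in> head ` set (e # w')" by simp
  then obtain y b z where yz: "u @ [e] = y @ b # z" and b: "head b \<in> head ` set (e # w')"
    and first: "\<forall>b'\<in>set y. head b' \<notin> head ` set (e # w')"
    by (rule split_list_first_propE)
  obtain c where c: "c \<in> set (e # w')" "head b = head c" using b by blast
  obtain y2 z2 where ws: "e # w' = y2 @ c # z2" using split_list[OF c(1)] by blast
  have z2: "set z2 \<subseteq> set w'" using ws by (cases y2) auto
  have yb: "set (y @ [b]) \<subseteq> set (u @ [e])" unfolding yz by auto
  have "p = (u @ [e]) @ u'" using p_eq by simp
  also have "\<dots> = y @ b # (z @ u')" unfolding yz by simp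
  finally have p_eq': "p = y @ b # (z @ u')" .
  have q_eq': "q = w @ y2 @ c # z2" using q_eq ws by simp
  have ryb: "rtrail (y @ [b])" using rp unfolding p_eq' by (rule rtrail_prefix_last)
  have R: "rtrail (y @ b # z2)"
  proof (cases "z2 = []")
    case True
    then show ?thesis using ryb by simp
  next
    case False
    have "rtrail ((y @ [b]) @ z2)"
    proof (rule rtrail_append[OF ryb False])
      have "link B c (hd z2)"
        using rq False unfolding q_eq' rtrail_def
        by (simp add: successively_append_iff successively_Cons)
      moreover have "sign_of B (edge b) (head c) = sign_of B (edge c) (head c)"
        using same_sign[of b c] c yb by simp
      ultimately show "link B (last (y @ [b])) (hd z2)"
        using c(2) by (auto simp: link_def)
      show "successively (link B) z2" "set z2 \<subseteq> oriented_edges B" "distinct (map edge z2)"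
        using rq unfolding q_eq' rtrail_def
        by (auto simp: successively_append_iff successively_Cons)
      show "edge ` set (y @ [b]) \<inter> edge ` set z2 = {}" using fresh yb z2 by blast
      have "set (butlast z2) \<subseteq> set q" unfolding q_eq' by (auto dest: in_set_butlastD)
      then show "r \<notin> head ` set (butlast z2)" using rtrail_head_neq_root[OF rq] by blast
    qed
    then show ?thesis by simp
  qed
  have heads: "distinct (map head (y @ b # z2))"
  proof -
    have "distinct (map head (y @ [b]))" using hp unfolding p_eq' by auto
    moreover have "distinct (map head (c # z2))" using hq unfolding q_eq' by auto
    moreover have "head ` set y \<inter> head ` set z2 = {}" using first z2 by auto
    ultimately show ?thesis using c(2) by auto
  qed
  have last_R: "head (last (y @ b # z2)) = x \<and> last q \<in> set (y @ b # z2)"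
  proof (cases "z2 = []")
    case False
    then have "last (y @ b # z2) = last q" "last q \<in> set z2" unfolding q_eq' by simp_all
    then show ?thesis using xq by simp
  next
    case True
    \<comment> \<open>Here the new path ends with \<open>b\<close>, and must still use the last edge
      of \<open>q\<close>. As \<open>p\<close> reaches \<open>x\<close> only at its end,
      \<open>b\<close> is last on \<open>p\<close>, hence \<open>b = e\<close>; as \<open>q\<close>
      repeats no vertex, also \<open>c = e\<close>.\<close>
    then have "c = last q" using q_eq' by simp
    then have "head b = head (last p)" using c(2) xq xp by simp
    moreover have "b \<in> set p" using p_eq' by simp
    moreover have "last p \<in> set p" using rp by (simp add: rtrail_def)
    ultimately have "b = last p" using hp by (simp add: distinct_map inj_on_def)
    moreover have "b \<in> set (u @ [e])" using yb by simp
    ultimately have "b = e"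
      using dp p_eq by (cases u' rule: rev_cases) auto
    moreover have "c \<in> set q" using q_eq' by simp
    ultimately have "c = e" using c(2) hq e(3) by (simp add: distinct_map inj_on_def)
    then show ?thesis using \<open>c = last q\<close> \<open>b = e\<close> xq True by simp
  qed
  have hd_eq: "hd p = hd (y @ b # z2)" unfolding p_eq' by (cases y) simp_all
  have hd_R: "hd p \<in> set (y @ b # z2)" unfolding hd_eq by (rule hd_in_set) simp
  show thesis
  proof
    show "path B r (y @ b # z2) x" using path_iff[OF x_neq] R heads last_R by blast
    show "edge (hd p) \<in> edge ` set (y @ b # z2)" using hd_R by (rule imageI)
    show "edge (last q) \<in> edge ` set (y @ b # z2)" using last_R by blast
    show "set (y @ b # z2) \<subseteq> initial p \<union> (terminal q - S)" using yb z2 ini ter by auto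
  qed
qed

text \<open>A path without a switch is kept. The last conjunct records the origin of every edge,
  from which edge-disjointness is derived later.\<close>

lemma linkage_of_path:
  assumes p: "p \<in> P"
  shows "\<exists>R. path B r R x \<and> edge (hd p) \<in> edge ` set R \<and>
    (\<forall>q\<in>Q. S \<inter> set p \<inter> set q \<noteq> {} \<longrightarrow> edge (last q) \<in> edge ` set R) \<and>
    (\<forall>b\<in>set R. b \<in> initial p \<or> (\<exists>q\<in>Q. S \<inter> set p \<inter> set q \<noteq> {} \<and> b \<in> terminal q - S))"
proof (cases "S \<inter> set p = {}")
  case True
  have "path B r p x" using P p by (simp add: edge_disjoint_paths_def)
  moreover have "edge (hd p) \<in> edge ` set p" using system_rtrail[of p] p by (simp add: rtrail_def)
  moreover have "set p \<subseteq> initial p" using initial_all True by blast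
  ultimately show ?thesis using True by blast
next
  case False
  then obtain e where e: "e \<in> S" "e \<in> set p" by blast
  then obtain q where q: "q \<in> Q" "e \<in> set q" using S_common unfolding common_def by blast
  obtain R where R: "path B r R x" "edge (hd p) \<in> edge ` set R" "edge (last q) \<in> edge ` set R"
    "set R \<subseteq> initial p \<union> (terminal q - S)"
    by (rule splice[OF p q(1) e q(2)])
  have "q' = q" if q': "q' \<in> Q" and meet: "S \<inter> set p \<inter> set q' \<noteq> {}" for q'
  proof -
    obtain s where s: "s \<in> S" "s \<in> set p" "s \<in> set q'" using meet by blast
    have "s = e" by (rule S_unique_P[OF s(1) e(1) p s(2) e(2)])
    then show ?thesis using Q_unique[OF q' q(1) s(3) q(2)] by simp
  qed
  then have "\<forall>q'\<in>Q. S \<inter> set p \<inter> set q' \<noteq> {} \<longrightarrow> edge (last q') \<in> edge ` set R"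
    using R(3) by blast
  moreover have "S \<inter> set p \<inter> set q \<noteq> {}" using e q(2) by blast
  then have "\<forall>b\<in>set R. b \<in> initial p \<or>
      (\<exists>q\<in>Q. S \<inter> set p \<inter> set q \<noteq> {} \<and> b \<in> terminal q - S)"
    using R(4) q(1) by blast
  ultimately show ?thesis using R(1,2) by blast
qed

section \<open>Assembling the linkage\<close>

lemma linkage_exists:
  "\<exists>R. edge_disjoint_paths B r x R \<and>
     (\<forall>p\<in>P. \<exists>q\<in>R. edge (hd p) \<in> edge ` set q) \<and>
     (\<forall>p\<in>Q. \<exists>q\<in>R. edge (last p) \<in> edge ` set q)"
proof -
  have "\<forall>p\<in>P. \<exists>R. path B r R x \<and> edge (hd p) \<in> edge ` set R \<and>
      (\<forall>q\<in>Q. S \<inter> set p \<inter> set q \<noteq> {} \<longrightarrow> edge (last q) \<in> edge ` set R) \<and>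
      (\<forall>b\<in>set R. b \<in> initial p \<or> (\<exists>q\<in>Q. S \<inter> set p \<inter> set q \<noteq> {} \<and> b \<in> terminal q - S))"
    by (rule ballI) (rule linkage_of_path)
  then obtain F where F: "\<forall>p\<in>P. path B r (F p) x \<and> edge (hd p) \<in> edge ` set (F p) \<and>
      (\<forall>q\<in>Q. S \<inter> set p \<inter> set q \<noteq> {} \<longrightarrow> edge (last q) \<in> edge ` set (F p)) \<and>
      (\<forall>b\<in>set (F p). b \<in> initial p \<or>
        (\<exists>q\<in>Q. S \<inter> set p \<inter> set q \<noteq> {} \<and> b \<in> terminal q - S))"
    by (rule bchoice[THEN exE])
  \<comment> \<open>Paths of \<open>Q\<close> without a switch are kept unchanged, so that their
    last edges are covered as well.\<close>
  define U where "U = {q \<in> Q. S \<inter> set q = {}}"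
  have F_edges: "b \<in> initial p \<or> (\<exists>q\<in>Q. S \<inter> set p \<inter> set q \<noteq> {} \<and> b \<in> terminal q - S)"
    if "p \<in> P" "b \<in> set (F p)" for p b
    using F that by blast
  have initial_terminal_switch: "S \<inter> set p \<inter> set q \<noteq> {} \<and> b \<in> S"
    if "p \<in> P" "q \<in> Q" "b \<in> initial p" "c \<in> terminal q" "edge b = edge c" for p q b c
  proof -
    have "b = c \<and> b \<in> S" using initial_terminal[OF that] .
    moreover have "b \<in> set p" "c \<in> set q" using that(3,4) initial_subset terminal_subset by blast+
    ultimately show ?thesis by blast
  qed
  have FF: "p1 = p2"
    if p1: "p1 \<in> P" and p2: "p2 \<in> P" and b: "b \<in> set (F p1)" and c: "c \<in> set (F p2)"
      and bc: "edge b = edge c" for p1 p2 b c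
  proof -
    \<comment> \<open>An edge shared by an initial and a terminal stretch is a switch, but switches
      were removed from the terminal ones.\<close>
    have mixed: False if "p \<in> P" "q \<in> Q" "b' \<in> initial p" "c' \<in> terminal q - S" "edge b' = edge c'"
      for p q b' c'
      using initial_terminal[of p q b' c'] that by blast
    consider "b \<in> initial p1" "c \<in> initial p2"
      | q1 q2 where "q1 \<in> Q" "S \<inter> set p1 \<inter> set q1 \<noteq> {}" "b \<in> terminal q1"
          "q2 \<in> Q" "S \<inter> set p2 \<inter> set q2 \<noteq> {}" "c \<in> terminal q2"
      using F_edges[OF p1 b] F_edges[OF p2 c] mixed[OF p1 _ _ _ bc] mixed[OF p2 _ _ _ bc[symmetric]]
      by blast
    then show ?thesis
    proof cases
      case 1
      then have "b \<in> set p1" "c \<in> set p2" using initial_subset by blast+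
      then show ?thesis using P_unique[OF p1 p2 _ _ bc] by blast
    next
      case 2
      then have "b \<in> set q1" "c \<in> set q2" using terminal_subset by blast+
      \<comment> \<open>Both edges come from the same path of \<open>Q\<close>; its only switch lies
        on \<open>p1\<close> and on \<open>p2\<close>, so these coincide.\<close>
      then have "q1 = q2" using Q_unique[OF 2(1,4) _ _ bc] by blast
      obtain s where s: "s \<in> S" "s \<in> set p1" "s \<in> set q1" using 2(2) by blast
      obtain t where t: "t \<in> S" "t \<in> set p2" "t \<in> set q1" using 2(5) \<open>q1 = q2\<close> by blast
      have "s = t" by (rule S_unique_Q[OF s(1) t(1) 2(1) s(3) t(3)])
      then show ?thesis using P_unique[OF p1 p2 s(2) t(2)] by simp
    qed
  qed
  have FU: "edge b \<noteq> edge c" if p: "p \<in> P" and q: "q \<in> U" and b: "b \<in> set (F p)"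
    and c: "c \<in> set q" for p q b c
  proof
    assume bc: "edge b = edge c"
    have qQ: "q \<in> Q" and qS: "set q \<inter> S = {}" using q by (auto simp: U_def)
    have ct: "c \<in> terminal q" using terminal_all[OF qS] c by blast
    consider "b \<in> initial p"
      | q' where "q' \<in> Q" "S \<inter> set p \<inter> set q' \<noteq> {}" "b \<in> terminal q'"
      using F_edges[OF p b] by blast
    then show False
    proof cases
      case 1
      then show False using initial_terminal_switch[OF p qQ _ ct bc] qS by blast
    next
      case 2
      then have "b \<in> set q'" using terminal_subset by blast
      then have "q' = q" using Q_unique[OF 2(1) qQ _ c bc] by simp
      then show False using 2(2) qS by blast
    qed
  qed
  have UU: "q = q'" if "q \<in> U" "q' \<in> U" "b \<in> set q" "c \<in> set q'" "edge b = edge c" for q q' b c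
    using Q_unique[OF _ _ that(3-5)] that(1,2) by (simp add: U_def)
  have "pairwise edge_disjoint (F ` P \<union> U)"
  proof (rule pairwiseI)
    fix R R' assume R: "R \<in> F ` P \<union> U" "R' \<in> F ` P \<union> U" "R \<noteq> R'"
    have "edge b \<noteq> edge c" if b: "b \<in> set R" and c: "c \<in> set R'" for b c
    proof
      assume bc: "edge b = edge c"
      consider p p' where "p \<in> P" "R = F p" "p' \<in> P" "R' = F p'"
        | p where "p \<in> P" "R = F p" "R' \<in> U"
        | p where "R \<in> U" "p \<in> P" "R' = F p"
        | "R \<in> U" "R' \<in> U"
        using R(1,2) by blast
      then show False
      proof cases
        case 1
        then show False using FF[of p p' b c] b c bc R(3) by simp
      next
        case 2
        then show False using FU[of p R' b c] b c bc by simp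
      next
        case 3
        then show False using FU[of p R c b] b c bc by simp
      next
        case 4
        then show False using UU[of R R' b c] b c bc R(3) by simp
      qed
    qed
    then show "edge_disjoint R R'" unfolding edge_disjoint_def by blast
  qed
  moreover have "\<forall>R\<in>F ` P \<union> U. path B r R x"
    using F Q unfolding U_def edge_disjoint_paths_def by blast
  moreover have "\<forall>p\<in>P. \<exists>R\<in>F ` P \<union> U. edge (hd p) \<in> edge ` set R" using F by blast
  moreover have "\<exists>R\<in>F ` P \<union> U. edge (last q) \<in> edge ` set R" if q: "q \<in> Q" for q
  proof (cases "S \<inter> set q = {}")
    case True
    then have "q \<in> U" using q by (simp add: U_def)
    moreover have "edge (last q) \<in> edge ` set q"
      using system_rtrail[of q] q by (simp add: rtrail_def)
    ultimately show ?thesis by blast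
  next
    case False
    then obtain e where e: "e \<in> S" "e \<in> set q" by blast
    then obtain p where p: "p \<in> P" "e \<in> set p" using S_common unfolding common_def by blast
    have "S \<inter> set p \<inter> set q \<noteq> {}" using e p(2) by blast
    then have "edge (last q) \<in> edge ` set (F p)" using F p(1) q by blast
    then show ?thesis using p(1) by blast
  qed
  ultimately show ?thesis
    unfolding edge_disjoint_paths_def by (intro exI[of _ "F ` P \<union> U"] conjI ballI) blast+
qed

end

theorem theorem6p3:
  fixes B :: "('v, 'e) bidirected_graph"
    and r x :: 'v
    and P Q :: "('v, 'e) oriented_edge list set"
  assumes "finite_bidirected_graph B"
    and "r \<in> verts B"
    and "edge_clean B r"
    and "x \<in> verts B - {r}"
    and "edge_disjoint_paths B r x P"
    and "edge_disjoint_paths B r x Q"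
  shows "\<exists>R. edge_disjoint_paths B r x R \<and>
           (\<forall>p\<in>P. \<exists>q\<in>R. edge (hd p) \<in> edge ` set q) \<and>
           (\<forall>p\<in>Q. \<exists>q\<in>R. edge (last p) \<in> edge ` set q)"
proof -
  interpret two_path_systems B r x P Q using assms by unfold_locales auto
  have *: "transp_on common earlier" "irreflp_on common earlier"
    "transp_on common later" "irreflp_on common later"
    using earlier_transp earlier_irreflp later_transp later_irreflp
    by (meson transp_on_subset irreflp_on_subset subset_UNIV)+
  show ?thesis
  proof (rule stable_set_exists[OF finite_common *])
    fix S
    assume "S \<subseteq> common" "\<And>s t. \<lbrakk>s \<in> S; t \<in> S\<rbrakk> \<Longrightarrow> \<not> earlier s t \<and> \<not> later s t"
      "\<And>e. \<lbrakk>e \<in> common; e \<notin> S\<rbrakk> \<Longrightarrow> \<exists>s\<in>S. earlier s e \<or> later s e"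
    then interpret stable_switches B r x P Q S by unfold_locales
    show ?thesis by (rule linkage_exists)
  qed
qed

end
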